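(* If $n\geq 3$, then $$\widetilde{R}_3(\mathcal{T}_{k(n)+1};n)\geq \widetilde{R}'_3(\mathcal{T}_{k(n)+1};n)\geq\Omega(n^2),$$ where the last assertion means that there is an absolute constant $c>0$ such that $\widetilde{R}'_3(\mathcal{T}_{k(n)+1};n)\geq c\,n^2$ for all $n\geq 3$.
   Context: $k(n):=\frac n2+1$ if $n\equiv 2\pmod 4$ and $k(n):=\lceil n/2\rceil$ otherwise. $\mathcal{T}_m$ denotes the family of all trees on $m$ vertices. The games, for a family of graphs $\mathcal{G}$ (here $\mathcal{G}=\mathcal{T}_{k(n)+1}$): in both games Builder repeatedly queries edges of $K_n$ (adaptively) and Painter reveals the color in $[3]=\{1,2,3\}$ of each queried edge according to a coloring of $E(K_n)$ hidden from Builder; queried edges are called exposed. After $\ell$ queries, let $C_1,C_2,C_3$ be the exposed color classes ($C_i$ = set of exposed edges of color $i$). Locating game: Painter may use any coloring $E(K_n)\to[3]$. Builder has won if either (1) for some $i\in[3]$, $C_i$ contains a copy of some $G\in\mathcal{G}$, or (2) every coloring $\chi:E(K_n)\to[3]$ with $C_i\subseteq\chi^{-1}(i)$ for all $i$ contains no monochromatic copy of any $G\in\mathcal{G}$ in any color. $\widetilde{R}_3(\mathcal{G};n)$ is the smallest $\ell$ for which Builder can guarantee to win the locating game on $K_n$ with at most $\ell$ queries, regardless of Painter's strategy. Cornering game: call a coloring $\chi:E(K_n)\to[3]$ valid if it contains a monochromatic copy of some $G\in\mathcal{G}$ in some color. Painter is required to use a valid coloring. Builder has won if there is a fixed color $c\in[3]$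 such that every valid coloring $\chi$ with $C_i\subseteq\chi^{-1}(i)$ for all $i\in[3]$ contains a copy of some $G\in\mathcal{G}$ in color $c$. $\widetilde{R}'_3(\mathcal{G};n)$ is the smallest $\ell$ for which Builder can guarantee to win the cornering game on $K_n$ with at most $\ell$ queries, regardless of Painter's strategy. *)

theory Defs
  imports Complex_Main "HOL-Library.FuncSet"
begin

text \<open>A graph is a pair of a vertex set and a set of edges, each edge being a two-element
  set of vertices.  Since only finite graphs up to isomorphism matter, all graphs live on
  natural numbers.\<close>

type_synonym graph = "nat set \<times> nat set set"

definition simple_graph :: "graph \<Rightarrow> bool" where
  "simple_graph G \<longleftrightarrow> finite (fst G) \<and> (\<forall>e\<in>snd G. e \<subseteq> fst G \<and> card e = 2)"

definition connected_graph :: "graph \<Rightarrow> bool" where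
  "connected_graph G \<longleftrightarrow>
     fst G \<noteq> {} \<and> (\<forall>u\<in>fst G. \<forall>v\<in>fst G. (u, v) \<in> {(x, y). {x, y} \<in> snd G}\<^sup>*)"

definition is_cycle :: "graph \<Rightarrow> nat list \<Rightarrow> bool" where
  "is_cycle G xs \<longleftrightarrow> length xs \<ge> 3 \<and> distinct xs \<and>
     (\<forall>i<length xs. {xs ! i, xs ! (Suc i mod length xs)} \<in> snd G)"

definition is_tree :: "graph \<Rightarrow> bool" where
  "is_tree G \<longleftrightarrow> simple_graph G \<and> connected_graph G \<and> (\<nexists>xs. is_cycle G xs)"

definition trees :: "nat \<Rightarrow> graph set" where
  "trees m = {G. is_tree G \<and> card (fst G) = m}"

text \<open>A copy is a not necessarily induced subgraph isomorphic to \<open>G\<close>.\<close>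

definition contains_copy :: "graph \<Rightarrow> graph \<Rightarrow> bool" where
  "contains_copy H G \<longleftrightarrow>
     (\<exists>f. inj_on f (fst G) \<and> f ` fst G \<subseteq> fst H \<and> (\<forall>e\<in>snd G. f ` e \<in> snd H))"

definition edges_K :: "nat \<Rightarrow> nat set set" where
  "edges_K n = {e. e \<subseteq> {..<n} \<and> card e = 2}"

definition colorings :: "nat \<Rightarrow> (nat set \<Rightarrow> nat) set" where
  "colorings n = edges_K n \<rightarrow>\<^sub>E {1..3}"

definition contains_member :: "nat \<Rightarrow> graph set \<Rightarrow> nat set set \<Rightarrow> bool" where
  "contains_member n \<G> C \<longleftrightarrow> (\<exists>G\<in>\<G>. contains_copy ({..<n}, C) G)"

definition color_class :: "nat \<Rightarrow> (nat set \<Rightarrow> nat) \<Rightarrow> nat \<Rightarrow> nat set set" where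
  "color_class n \<chi> i = {e \<in> edges_K n. \<chi> e = i}"

definition valid_colorings :: "nat \<Rightarrow> graph set \<Rightarrow> (nat set \<Rightarrow> nat) set" where
  "valid_colorings n \<G> =
     {\<chi> \<in> colorings n. \<exists>i\<in>{1..3}. contains_member n \<G> (color_class n \<chi> i)}"

text \<open>A history lists the queried edges with the revealed colors, oldest first.
  A strategy of Builder chooses the next edge depending on the history; edges may be queried
  again, which gives no information but is still counted.\<close>

type_synonym history = "(nat set \<times> nat) list"

definition exposed :: "history \<Rightarrow> nat \<Rightarrow> nat set set" where
  "exposed h i = {e. (e, i) \<in> set h}"

definition consistent :: "nat \<Rightarrow> history \<Rightarrow> (nat set \<Rightarrow> nat) \<Rightarrow> bool" where
  "consistent n h \<chi> \<longleftrightarrow> (\<forall>i\<in>{1..3}. exposed h i \<subseteq> color_class n \<chi> i)"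

primrec play :: "(history \<Rightarrow> nat set) \<Rightarrow> (nat set \<Rightarrow> nat) \<Rightarrow> nat \<Rightarrow> history" where
  "play S \<chi> 0 = []"
| "play S \<chi> (Suc t) = play S \<chi> t @ [(S (play S \<chi> t), \<chi> (S (play S \<chi> t)))]"

text \<open>\<open>P\<close> is the set of colorings Painter may hide and \<open>won\<close> describes the histories at which
  Builder has won.  As strategies are deterministic, an adaptive Painter bound to some coloring
  in \<open>P\<close> is no more powerful than one fixing it in advance.\<close>

definition builder_can_win ::
  "nat \<Rightarrow> (nat set \<Rightarrow> nat) set \<Rightarrow> (history \<Rightarrow> bool) \<Rightarrow> nat \<Rightarrow> bool" where
  "builder_can_win n P won l \<longleftrightarrow>
     (\<exists>S. (\<forall>h. S h \<in> edges_K n) \<and> (\<forall>\<chi>\<in>P. \<exists>t\<le>l. won (play S \<chi> t)))"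

definition locating_won :: "nat \<Rightarrow> graph set \<Rightarrow> history \<Rightarrow> bool" where
  "locating_won n \<G> h \<longleftrightarrow>
     (\<exists>i\<in>{1..3}. contains_member n \<G> (exposed h i)) \<or>
     (\<forall>\<chi>\<in>colorings n. consistent n h \<chi> \<longrightarrow>
        \<not> (\<exists>i\<in>{1..3}. contains_member n \<G> (color_class n \<chi> i)))"

definition cornering_won :: "nat \<Rightarrow> graph set \<Rightarrow> history \<Rightarrow> bool" where
  "cornering_won n \<G> h \<longleftrightarrow>
     (\<exists>c\<in>{1..3}. \<forall>\<chi>\<in>valid_colorings n \<G>.
        consistent n h \<chi> \<longrightarrow> contains_member n \<G> (color_class n \<chi> c))"

definition locating_number :: "graph set \<Rightarrow> nat \<Rightarrow> nat" where
  "locating_number \<G> n = (LEAST l. builder_can_win n (colorings n) (locating_won n \<G>) l)"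

definition cornering_number :: "graph set \<Rightarrow> nat \<Rightarrow> nat" where
  "cornering_number \<G> n =
     (LEAST l. builder_can_win n (valid_colorings n \<G>) (cornering_won n \<G>) l)"

definition k_fun :: "nat \<Rightarrow> nat" where
  "k_fun n = (if n mod 4 = 2 then n div 2 + 1 else nat \<lceil>real n / 2\<rceil>)"

text \<open>For \<open>n \<ge> 2\<close> Builder can win both games by querying every edge, so the two minima above
  are attained.\<close>

lemma play_enumerate:
  assumes "es \<noteq> []"
  defines "S \<equiv> \<lambda>h::history. es ! (length h mod length es)"
  shows "play S \<chi> t = map (\<lambda>j. (es ! (j mod length es), \<chi> (es ! (j mod length es)))) [0..<t]"
  by (induction t) (simp_all add: S_def)

lemma query_all_edges:
  assumes "n \<ge> 2"
  obtains S where "\<And>h. S h \<in> edges_K n"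
    and "\<And>\<chi> i. exposed (play S \<chi> (card (edges_K n))) i = color_class n \<chi> i"
proof -
  have fin: "finite (edges_K n)"
    unfolding edges_K_def by (rule finite_subset[of _ "Pow {..<n}"]) auto
  then obtain es where es: "set es = edges_K n" "distinct es"
    using finite_distinct_list by blast
  have "{0, 1} \<in> edges_K n"
    using assms by (auto simp: edges_K_def)
  hence ne: "es \<noteq> []" using es by auto
  define S where "S = (\<lambda>h::history. es ! (length h mod length es))"
  have len: "length es = card (edges_K n)" using es distinct_card by metis
  show thesis
  proof
    show "S h \<in> edges_K n" for h
      using ne es by (auto simp: S_def simp flip: es(1))
    show "exposed (play S \<chi> (card (edges_K n))) i = color_class n \<chi> i" for \<chi> i
      unfolding S_def play_enumerate[OF ne] len[symmetric] exposed_def color_class_def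
      by (auto simp: in_set_conv_nth image_iff simp flip: es(1))
  qed
qed

lemma consistent_all_exposed:
  assumes "\<And>i. exposed h i = color_class n \<chi> i" "\<chi> \<in> colorings n" "\<chi>' \<in> colorings n"
    and "consistent n h \<chi>'"
  shows "\<chi>' = \<chi>"
proof (rule PiE_ext)
  show "\<chi>' \<in> edges_K n \<rightarrow>\<^sub>E {1..3}" "\<chi> \<in> edges_K n \<rightarrow>\<^sub>E {1..3}"
    using assms by (simp_all add: colorings_def)
  fix e assume e: "e \<in> edges_K n"
  hence "\<chi> e \<in> {1..3}" using assms(2) by (auto simp: colorings_def)
  thus "\<chi>' e = \<chi> e"
    using assms(1,4) e by (auto simp: consistent_def color_class_def)
qed

lemma locating_winnable:
  assumes "n \<ge> 2"
  shows "builder_can_win n (colorings n) (locating_won n \<G>) (card (edges_K n))"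
proof -
  obtain S where S: "\<And>h. S h \<in> edges_K n"
    "\<And>\<chi> i. exposed (play S \<chi> (card (edges_K n))) i = color_class n \<chi> i"
    using query_all_edges[OF assms] by blast
  have "locating_won n \<G> (play S \<chi> (card (edges_K n)))" if "\<chi> \<in> colorings n" for \<chi>
    unfolding locating_won_def S(2) using consistent_all_exposed[OF S(2) that] by blast
  thus ?thesis unfolding builder_can_win_def using S(1) by blast
qed

lemma cornering_winnable:
  assumes "n \<ge> 2"
  shows "builder_can_win n (valid_colorings n \<G>) (cornering_won n \<G>) (card (edges_K n))"
proof -
  obtain S where S: "\<And>h. S h \<in> edges_K n"
    "\<And>\<chi> i. exposed (play S \<chi> (card (edges_K n))) i = color_class n \<chi> i"
    using query_all_edges[OF assms] by blast
  have "cornering_won n \<G> (play S \<chi> (card (edges_K n)))" if "\<chi> \<in> valid_colorings n \<G>" for \<chi>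
  proof -
    from that have c: "\<chi> \<in> colorings n" by (simp add: valid_colorings_def)
    from that obtain i where "i \<in> {1..3}" "contains_member n \<G> (color_class n \<chi> i)"
      by (auto simp: valid_colorings_def)
    moreover have "\<chi>' = \<chi>" if "\<chi>' \<in> valid_colorings n \<G>"
      "consistent n (play S \<chi> (card (edges_K n))) \<chi>'" for \<chi>'
      using consistent_all_exposed[OF S(2) c] that by (simp add: valid_colorings_def)
    ultimately show ?thesis unfolding cornering_won_def by metis
  qed
  thus ?thesis unfolding builder_can_win_def using S(1) by blast
qed

end

theory Submission
  imports Defs
begin

text \<open>
  The first inequality holds because a strategy for the locating game also wins the cornering
  game: against a valid coloring Builder can only win the locating game by exposing a
  monochromatic copy, and its color then serves as the cornered color.

  The lower bound is an adversary argument. Split the vertices into four classes of almost equal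
  size, regarded as the points of the affine plane of order 2, and give each edge joining two
  classes the direction of the line through them. There are three directions, and a line is a
  union of two classes, so every monochromatic component lies in such a union and has at most
  \<open>k_fun n\<close> vertices: this coloring is not valid. Recoloring any single edge between two
  classes \<open>A\<close> and \<open>B\<close>, however, joins the two parallel lines of its new direction, so that the
  new color becomes connected on all \<open>n\<close> vertices, while the other two colors still have only
  small components. Since there are two possible new colors, an edge between \<open>A\<close> and \<open>B\<close> that
  has not been queried leaves it open which color contains the large component. Builder
  therefore needs to query all \<open>card A * card B\<close> of these edges, which is quadratic in \<open>n\<close>
  (\<open>cornering_win_needs_pivotal_edges\<close> and the lemmas on the affine coloring).
\<close>

section \<open>Locating versus cornering\<close>

lemma contains_member_mono:
  assumes "contains_member n \<G> C" "C \<subseteq> D"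
  shows "contains_member n \<G> D"
  using assms unfolding contains_member_def contains_copy_def fst_conv snd_conv
  by (meson subsetD)

lemma play_mono:
  assumes "t \<le> l"
  shows "set (play S \<chi> t) \<subseteq> set (play S \<chi> l)"
  using assms by (induction rule: dec_induct) auto

lemma length_play: "length (play S \<chi> t) = t"
  by (induction t) auto

lemma consistent_play:
  assumes "\<And>h. S h \<in> edges_K n"
  shows "consistent n (play S \<chi> t) \<chi>"
proof -
  have "e \<in> edges_K n \<and> \<chi> e = i" if "(e, i) \<in> set (play S \<chi> t)" for e i
    using that assms by (induction t) auto
  thus ?thesis by (auto simp: consistent_def exposed_def color_class_def)
qed

text \<open>Against a valid coloring the second winning condition of the locating game can never hold,
  since the hidden coloring itself refutes it.\<close>

lemma locating_won_imp_cornering_won: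
  assumes "locating_won n \<G> h" "\<chi> \<in> valid_colorings n \<G>" "consistent n h \<chi>"
  shows "cornering_won n \<G> h"
proof -
  have "\<not> (\<forall>\<chi>\<in>colorings n. consistent n h \<chi> \<longrightarrow>
        \<not> (\<exists>i\<in>{1..3}. contains_member n \<G> (color_class n \<chi> i)))"
    using assms(2,3) unfolding valid_colorings_def by blast
  then obtain i where i: "i \<in> {1..3}" "contains_member n \<G> (exposed h i)"
    using assms(1) unfolding locating_won_def by blast
  have "contains_member n \<G> (color_class n \<chi>' i)" if "consistent n h \<chi>'" for \<chi>'
    using contains_member_mono[OF i(2)] that i(1) unfolding consistent_def by blast
  thus ?thesis unfolding cornering_won_def using i(1) by blast
qed

lemma cornering_le_locating:
  assumes "n \<ge> 2"
  shows "cornering_number \<G> n \<le> locating_number \<G> n"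
proof -
  let ?l = "locating_number \<G> n"
  have "builder_can_win n (colorings n) (locating_won n \<G>) ?l"
    unfolding locating_number_def
    by (rule LeastI[where P = "builder_can_win n (colorings n) (locating_won n \<G>)",
          OF locating_winnable[OF assms]])
  then obtain S where S: "\<And>h. S h \<in> edges_K n"
    and win: "\<And>\<chi>. \<chi> \<in> colorings n \<Longrightarrow> \<exists>t\<le>?l. locating_won n \<G> (play S \<chi> t)"
    unfolding builder_can_win_def by blast
  have "\<exists>t\<le>?l. cornering_won n \<G> (play S \<chi> t)" if \<chi>: "\<chi> \<in> valid_colorings n \<G>" for \<chi>
  proof -
    have "\<chi> \<in> colorings n" using \<chi> by (simp add: valid_colorings_def)
    then show ?thesis
      using win locating_won_imp_cornering_won[OF _ \<chi> consistent_play[of S n \<chi>, OF S]] by blast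
  qed
  hence "builder_can_win n (valid_colorings n \<G>) (cornering_won n \<G>) ?l"
    unfolding builder_can_win_def using S by blast
  thus ?thesis unfolding cornering_number_def by (rule Least_le)
qed

section \<open>The adversary bound\<close>

lemma play_recolor_unqueried:
  assumes "e \<notin> fst ` set (play S \<chi> t)"
  shows "play S (\<chi>(e := c)) t = play S \<chi> t"
  using assms by (induction t) (auto simp: image_Un)

text \<open>An edge is pivotal for a base coloring if it can be recolored in two ways for which no
  color is good for both. Let Painter answer by the base coloring: while a pivotal edge is
  unqueried, both recolorings are consistent with the answers, so no color is cornered. The base
  coloring itself may well be invalid; only its recolorings are ever hidden.\<close>

lemma cornering_win_needs_pivotal_edges:
  assumes win: "builder_can_win n (valid_colorings n \<G>) (cornering_won n \<G>) l"
  assumes pivotal: "\<And>e. e \<in> D \<Longrightarrow> \<exists>c c'.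
      \<chi>(e := c) \<in> valid_colorings n \<G> \<and> \<chi>(e := c') \<in> valid_colorings n \<G> \<and>
      (\<forall>i\<in>{1..3}. \<not> (contains_member n \<G> (color_class n (\<chi>(e := c)) i) \<and>
                     contains_member n \<G> (color_class n (\<chi>(e := c')) i)))"
  shows "card D \<le> l"
proof (rule ccontr)
  assume "\<not> card D \<le> l"
  obtain S where S: "\<And>h. S h \<in> edges_K n"
    and win: "\<And>\<chi>. \<chi> \<in> valid_colorings n \<G> \<Longrightarrow> \<exists>t\<le>l. cornering_won n \<G> (play S \<chi> t)"
    using win unfolding builder_can_win_def by blast
  let ?Q = "fst ` set (play S \<chi> l)"
  have "card ?Q \<le> card (set (play S \<chi> l))"
    by (rule card_image_le) simp
  also have "\<dots> \<le> l"
    using card_length[of "play S \<chi> l"] by (simp add: length_play)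
  finally have "\<not> D \<subseteq> ?Q"
    using \<open>\<not> card D \<le> l\<close> card_mono[of ?Q D] by auto
  then obtain e where e: "e \<in> D" "e \<notin> ?Q" by blast
  obtain c c' where c: "\<chi>(e := c) \<in> valid_colorings n \<G>" "\<chi>(e := c') \<in> valid_colorings n \<G>"
    and sep: "\<forall>i\<in>{1..3}. \<not> (contains_member n \<G> (color_class n (\<chi>(e := c)) i) \<and>
                           contains_member n \<G> (color_class n (\<chi>(e := c')) i))"
    using pivotal[OF e(1)] by blast
  obtain t where t: "t \<le> l" "cornering_won n \<G> (play S (\<chi>(e := c)) t)"
    using win[OF c(1)] by blast
  have "e \<notin> fst ` set (play S \<chi> t)"
    using e(2) play_mono[OF t(1)] by blast
  hence same: "play S (\<chi>(e := d)) t = play S \<chi> t" for d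
    by (rule play_recolor_unqueried)
  have "consistent n (play S \<chi> t) (\<chi>(e := d))" for d
    using consistent_play[of S n "\<chi>(e := d)" t, OF S] same by simp
  thus False
    using t(2) c sep unfolding cornering_won_def same by blast
qed

section \<open>Trees in edge sets\<close>

lemma is_tree_add_leaf:
  assumes tree: "is_tree (V, E)" and u: "u \<in> V" and v: "v \<notin> V"
  shows "is_tree (insert v V, insert {u, v} E)"
proof -
  let ?G = "(insert v V, insert {u, v} E) :: graph"
  have fin: "finite V" and E: "\<And>e. e \<in> E \<Longrightarrow> e \<subseteq> V \<and> card e = 2"
    and conn: "\<And>x y. x \<in> V \<Longrightarrow> y \<in> V \<Longrightarrow> (x, y) \<in> {(x, y). {x, y} \<in> E}\<^sup>*"
    and acyc: "\<And>xs. \<not> is_cycle (V, E) xs"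
    using tree by (auto simp: is_tree_def simple_graph_def connected_graph_def)
  have "u \<noteq> v" using u v by blast
  have "simple_graph ?G"
    using fin E u \<open>u \<noteq> v\<close> by (auto simp: simple_graph_def)
  moreover have "connected_graph ?G"
  proof -
    define R where "R = {(x, y). {x, y} \<in> snd ?G}"
    have "{(x, y). {x, y} \<in> E} \<subseteq> R" by (auto simp: R_def)
    hence conn_R: "(x, y) \<in> R\<^sup>*" if "x \<in> V" "y \<in> V" for x y
      using conn[OF that] rtrancl_mono by blast
    have edge: "(u, v) \<in> R\<^sup>*" "(v, u) \<in> R\<^sup>*"
      by (auto simp: R_def insert_commute)
    have hub: "(x, u) \<in> R\<^sup>* \<and> (u, x) \<in> R\<^sup>*" if "x \<in> insert v V" for x
      using that conn_R u edge by auto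
    have "(x, y) \<in> R\<^sup>*" if "x \<in> insert v V" "y \<in> insert v V" for x y
      using hub[OF that(1)] hub[OF that(2)] by (meson rtrancl_trans)
    thus ?thesis unfolding connected_graph_def R_def by simp
  qed
  moreover have "\<not> is_cycle ?G xs" for xs
  proof
    assume "is_cycle ?G xs"
    hence len: "length xs \<ge> 3" and dist: "distinct xs"
      and edges: "\<And>i. i < length xs \<Longrightarrow>
        {xs ! i, xs ! (Suc i mod length xs)} \<in> insert {u, v} E"
      by (auto simp: is_cycle_def)
    show False
    proof (cases "v \<in> set xs")
      case True
      \<comment> \<open>The predecessor and the successor of \<open>v\<close> on the cycle are different neighbors of
        \<open>v\<close>, but \<open>u\<close> is the only one.\<close>
      then obtain i where i: "i < length xs" "xs ! i = v"
        by (auto simp: in_set_conv_nth)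
      define j where "j = Suc i mod length xs"
      define i' where "i' = (if i = 0 then length xs - 1 else i - 1)"
      have j: "j < length xs"
        unfolding j_def using len by (intro mod_less_divisor) linarith
      have i': "i' < length xs" "Suc i' mod length xs = i"
        using i(1) len by (cases "i = 0"; simp add: i'_def)+
      have "{v, xs ! j} \<in> insert {u, v} E" "{xs ! i', v} \<in> insert {u, v} E"
        using edges[OF i(1)] edges[OF i'(1)] i i' by (auto simp: j_def)
      hence "xs ! j = u" "xs ! i' = u"
        using E v by (auto simp: doubleton_eq_iff)
      hence "j = i'" using dist j i'(1) nth_eq_iff_index_eq by metis
      moreover have "j = (if Suc i = length xs then 0 else Suc i)"
        using i(1) by (auto simp: j_def)
      ultimately show False using i(1) len by (auto simp: i'_def split: if_splits)
    next
      case False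
      have "{xs ! i, xs ! (Suc i mod length xs)} \<in> E" if "i < length xs" for i
      proof -
        have "Suc i mod length xs < length xs" using that by (intro mod_less_divisor) linarith
        hence "v \<notin> {xs ! i, xs ! (Suc i mod length xs)}"
          using that False nth_mem by blast
        thus ?thesis using edges[OF that] by blast
      qed
      hence "is_cycle (V, E) xs" using len dist by (simp add: is_cycle_def)
      thus False using acyc by blast
    qed
  qed
  ultimately show ?thesis unfolding is_tree_def by blast
qed

text \<open>Connectedness enters in the form in which a tree can be grown greedily: as long as its
  vertex set \<open>V\<close> is not everything, some edge leaves \<open>V\<close> and attaches a new leaf.\<close>

lemma contains_tree_if_cuts_crossed:
  assumes cut: "\<And>V. V \<noteq> {} \<Longrightarrow> V \<subset> {..<n} \<Longrightarrow>
      \<exists>u\<in>V. \<exists>v\<in>{..<n} - V. {u, v} \<in> C"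
    and m: "1 \<le> m" "m \<le> n"
  shows "contains_member n (trees m) C"
proof -
  have "\<exists>V E. is_tree (V, E) \<and> card V = m \<and> V \<subseteq> {..<n} \<and> E \<subseteq> C"
    using m
  proof (induction rule: dec_induct)
    case base
    have "\<not> is_cycle ({0}, {}) xs" for xs
      by (fastforce simp: is_cycle_def intro: exI[of _ 0])
    hence "is_tree ({0}, {})"
      by (simp add: is_tree_def simple_graph_def connected_graph_def)
    thus ?case using m by (intro exI[of _ "{0}"] exI[of _ "{}"]) auto
  next
    case (step m)
    then obtain V E where VE: "is_tree (V, E)" "card V = m" "V \<subseteq> {..<n}" "E \<subseteq> C"
      by auto
    have "finite V" using VE(3) finite_subset by blast
    have "V \<noteq> {}" "V \<subset> {..<n}" using VE step by auto
    then obtain u v where uv: "u \<in> V" "v \<in> {..<n} - V" "{u, v} \<in> C"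
      using cut by blast
    have "is_tree (insert v V, insert {u, v} E)"
      using is_tree_add_leaf VE(1) uv by blast
    moreover have "card (insert v V) = Suc m"
      using uv VE \<open>finite V\<close> by simp
    ultimately show ?case using VE uv
      by (intro exI[of _ "insert v V"] exI[of _ "insert {u, v} E"]) auto
  qed
  then obtain V E where VE: "is_tree (V, E)" "card V = m" "V \<subseteq> {..<n}" "E \<subseteq> C"
    by blast
  have "contains_copy ({..<n}, C) (V, E)"
    unfolding contains_copy_def using VE by (intro exI[of _ id]) auto
  thus ?thesis
    unfolding contains_member_def trees_def using VE by fastforce
qed

text \<open>Along the paths of an embedded tree the value of \<open>P\<close> cannot change, so the whole tree lies
  on one side. This bounds trees in \<open>C\<close> without determining the components of \<open>C\<close>.\<close>

lemma tree_within_side: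
  assumes "contains_member n (trees m) C"
    and pres: "\<forall>u v. {u, v} \<in> C \<longrightarrow> P u = P v"
  shows "m \<le> card {v. v < n \<and> P v} \<or> m \<le> card {v. v < n \<and> \<not> P v}"
proof -
  obtain G f where G: "is_tree G" "card (fst G) = m" and f: "inj_on f (fst G)"
    "f ` fst G \<subseteq> {..<n}" "\<And>e. e \<in> snd G \<Longrightarrow> f ` e \<in> C"
    using assms(1) by (auto simp: contains_member_def trees_def contains_copy_def)
  have conn: "connected_graph G" using G by (simp add: is_tree_def)
  then obtain r where r: "r \<in> fst G" by (auto simp: connected_graph_def)
  have "P (f x) = P (f r)" if "x \<in> fst G" for x
  proof -
    have "(r, x) \<in> {(x, y). {x, y} \<in> snd G}\<^sup>*"
      using conn r that by (simp add: connected_graph_def)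
    thus ?thesis
    proof induction
      case (step y z)
      have "{f y, f z} \<in> C" using f(3)[of "{y, z}"] step by simp
      thus ?case using pres step by blast
    qed simp
  qed
  hence "f ` fst G \<subseteq> {v. v < n \<and> P v} \<or> f ` fst G \<subseteq> {v. v < n \<and> \<not> P v}"
    using f(2) by (cases "P (f r)") auto
  moreover have "card (f ` fst G) = m" using card_image[OF f(1)] G by simp
  ultimately show ?thesis
    using card_mono[of "{v. v < n \<and> P v}"] card_mono[of "{v. v < n \<and> \<not> P v}"] by auto
qed

section \<open>The affine coloring\<close>

text \<open>The residue classes modulo 4 are given the coordinates \<open>(low v, even v)\<close> in the affine
  plane of order 2. The three parallel classes of lines are the level sets of the first
  coordinate, of the second coordinate, and of their sum, and an edge between two classes gets
  the direction of the line through them. The direction of an edge within a class is immaterial,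
  as the class lies on a line of every direction; it comes out as 1.\<close>

definition low :: "nat \<Rightarrow> bool" where
  "low v \<longleftrightarrow> v mod 4 < 2"

definition direction :: "nat \<Rightarrow> nat \<Rightarrow> nat" where
  "direction u v = (if low u = low v then 1 else if even u = even v then 2 else 3)"

text \<open>Minimum and maximum only serve to name the two ends of an edge; \<open>direction\<close> is
  symmetric.\<close>

definition affine_coloring :: "nat \<Rightarrow> nat set \<Rightarrow> nat" where
  "affine_coloring n = restrict (\<lambda>e. direction (Min e) (Max e)) (edges_K n)"

lemma direction_commute: "direction u v = direction v u"
  by (auto simp: direction_def)

lemma same_line_if_direction:
  "direction u v = 1 \<Longrightarrow> low u = low v"
  "direction u v = 2 \<Longrightarrow> even u = even v"
  "direction u v = 3 \<Longrightarrow> (low u = even u) = (low v = even v)"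
  unfolding direction_def
  by (cases "low u"; cases "low v"; cases "even u"; cases "even v"; simp)+

lemma doubleton_in_edges_K: "{u, v} \<in> edges_K n \<longleftrightarrow> u < n \<and> v < n \<and> u \<noteq> v"
  by (auto simp: edges_K_def card_2_iff doubleton_eq_iff)

lemma affine_coloring_doubleton:
  assumes "u < n" "v < n" "u \<noteq> v"
  shows "affine_coloring n {u, v} = direction u v"
  using assms direction_commute[of u v]
  by (simp add: affine_coloring_def doubleton_in_edges_K min_def max_def)

lemma affine_coloring_in_colorings: "affine_coloring n \<in> colorings n"
  unfolding colorings_def affine_coloring_def
  by (rule restrict_PiE_iff[THEN iffD2]) (simp add: direction_def)

lemma recolored_class_doubleton:
  "{u, v} \<in> color_class n ((affine_coloring n)(e := c)) i \<longleftrightarrow>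
     u < n \<and> v < n \<and> u \<noteq> v \<and> i = (if {u, v} = e then c else direction u v)"
  using affine_coloring_doubleton[of u n v]
  by (auto simp: color_class_def doubleton_in_edges_K)

lemma card_residue_class:
  assumes "i < 4"
  shows "card {v. v < n \<and> v mod 4 = i} = n div 4 + (if i < n mod 4 then 1 else 0)"
proof (induction n)
  case (Suc n)
  have "{v. v < Suc n \<and> v mod 4 = i} =
      (if n mod 4 = i then insert n {v. v < n \<and> v mod 4 = i} else {v. v < n \<and> v mod 4 = i})"
    by (auto simp: less_Suc_eq)
  hence "card {v. v < Suc n \<and> v mod 4 = i} =
      card {v. v < n \<and> v mod 4 = i} + (if n mod 4 = i then 1 else 0)"
    by simp
  thus ?case
    unfolding Suc using assms by (auto simp: div_Suc mod_Suc)
qed simp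

lemma card_two_residue_classes:
  assumes "i < 4" "j < 4" "i \<noteq> j"
  shows "card {v. v < n \<and> (v mod 4 = i \<or> v mod 4 = j)} =
    2 * (n div 4) + (if i < n mod 4 then 1 else 0) + (if j < n mod 4 then 1 else 0)"
proof -
  have "{v. v < n \<and> (v mod 4 = i \<or> v mod 4 = j)} =
      {v. v < n \<and> v mod 4 = i} \<union> {v. v < n \<and> v mod 4 = j}" by auto
  moreover have "card ({v. v < n \<and> v mod 4 = i} \<union> {v. v < n \<and> v mod 4 = j}) =
      card {v. v < n \<and> v mod 4 = i} + card {v. v < n \<and> v mod 4 = j}"
    using assms by (intro card_Un_disjoint) auto
  ultimately show ?thesis
    using card_residue_class[OF assms(1), of n] card_residue_class[OF assms(2), of n] by simp
qed

lemma k_fun_eq: "k_fun n = 2 * (n div 4) + min 2 (n mod 4)"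
proof -
  define m r where "m = n div 4" and "r = n mod 4"
  have n: "n = 4 * m + r" and "r < 4" by (simp_all add: m_def r_def)
  then consider "r = 0" | "r = 1" | "r = 2" | "r = 3" by linarith
  hence "k_fun n = 2 * m + min 2 r"
  proof cases
    case 1
    have "\<lceil>real n / 2\<rceil> = 2 * int m" by (rule ceiling_unique) (simp_all add: n 1)
    thus ?thesis using 1 by (simp add: k_fun_def n)
  next
    case 2
    have "\<lceil>real n / 2\<rceil> = 2 * int m + 1" by (rule ceiling_unique) (simp_all add: n 2)
    thus ?thesis using 2 by (simp add: k_fun_def n)
  next
    case 3
    have "n div 2 = 2 * m + 1" unfolding n 3 by linarith
    thus ?thesis using 3 r_def by (simp add: k_fun_def)
  next
    case 4
    have "\<lceil>real n / 2\<rceil> = 2 * int m + 2" by (rule ceiling_unique) (simp_all add: n 4)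
    thus ?thesis using 4 r_def by (simp add: k_fun_def)
  qed
  thus ?thesis by (simp add: m_def r_def)
qed

text \<open>This is where the case distinction in \<open>k_fun\<close> comes from: if \<open>n mod 4 = 2\<close>, the two larger
  classes lie on a common line, which then has \<open>n div 2 + 1\<close> vertices.\<close>

lemma card_two_residue_classes_le:
  assumes "i < 4" "j < 4" "i \<noteq> j"
  shows "card {v. v < n \<and> (v mod 4 = i \<or> v mod 4 = j)} \<le> k_fun n"
  unfolding card_two_residue_classes[OF assms] k_fun_eq using assms(3) by auto

lemma lines_le:
  "card {v. v < n \<and> low v} \<le> k_fun n" "card {v. v < n \<and> \<not> low v} \<le> k_fun n"
  "card {v. v < n \<and> even v} \<le> k_fun n" "card {v. v < n \<and> \<not> even v} \<le> k_fun n"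
  "card {v. v < n \<and> low v = even v} \<le> k_fun n" "card {v. v < n \<and> \<not> low v = even v} \<le> k_fun n"
proof -
  note line = card_two_residue_classes_le[of _ _ n]
  have "{v. v < n \<and> low v} = {v. v < n \<and> (v mod 4 = 0 \<or> v mod 4 = 1)}"
    unfolding low_def by (intro Collect_cong) presburger
  with line[of 0 1] show "card {v. v < n \<and> low v} \<le> k_fun n" by simp
  have "{v. v < n \<and> \<not> low v} = {v. v < n \<and> (v mod 4 = 2 \<or> v mod 4 = 3)}"
    unfolding low_def by (intro Collect_cong) presburger
  with line[of 2 3] show "card {v. v < n \<and> \<not> low v} \<le> k_fun n" by simp
  have "{v. v < n \<and> even v} = {v. v < n \<and> (v mod 4 = 0 \<or> v mod 4 = 2)}"
    by (intro Collect_cong) presburger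
  with line[of 0 2] show "card {v. v < n \<and> even v} \<le> k_fun n" by simp
  have "{v. v < n \<and> \<not> even v} = {v. v < n \<and> (v mod 4 = 1 \<or> v mod 4 = 3)}"
    by (intro Collect_cong) presburger
  with line[of 1 3] show "card {v. v < n \<and> \<not> even v} \<le> k_fun n" by simp
  have "{v. v < n \<and> low v = even v} = {v. v < n \<and> (v mod 4 = 0 \<or> v mod 4 = 3)}"
    unfolding low_def by (intro Collect_cong) presburger
  with line[of 0 3] show "card {v. v < n \<and> low v = even v} \<le> k_fun n" by simp
  have "{v. v < n \<and> \<not> low v = even v} = {v. v < n \<and> (v mod 4 = 1 \<or> v mod 4 = 2)}"
    unfolding low_def by (intro Collect_cong) presburger
  with line[of 1 2] show "card {v. v < n \<and> \<not> low v = even v} \<le> k_fun n" by simp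
qed

text \<open>The edges of a color that was not newly assigned stay on the lines of their direction.\<close>

lemma unchanged_color_has_no_large_tree:
  assumes "i \<in> {1..3}" "i \<noteq> c"
  shows "\<not> contains_member n (trees (k_fun n + 1)) (color_class n ((affine_coloring n)(e := c)) i)"
proof
  let ?C = "color_class n ((affine_coloring n)(e := c)) i"
  assume *: "contains_member n (trees (k_fun n + 1)) ?C"
  have dir: "direction u v = i" if "{u, v} \<in> ?C" for u v
    using that assms(2) by (simp add: recolored_class_doubleton split: if_splits)
  consider "i = 1" | "i = 2" | "i = 3"
    using assms(1) unfolding atLeastAtMost_iff by linarith
  thus False
  proof cases
    case 1
    have "\<forall>u v. {u, v} \<in> ?C \<longrightarrow> low u = low v"
      using same_line_if_direction(1) dir 1 by blast
    from tree_within_side[OF * this] show False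
      using lines_le(1,2)[of n] by linarith
  next
    case 2
    have "\<forall>u v. {u, v} \<in> ?C \<longrightarrow> even u = even v"
      using same_line_if_direction(2) dir 2 by blast
    from tree_within_side[OF * this] show False
      using lines_le(3,4)[of n] by linarith
  next
    case 3
    have "\<forall>u v. {u, v} \<in> ?C \<longrightarrow> (low u = even u) = (low v = even v)"
      using same_line_if_direction(3) dir 3 by blast
    from tree_within_side[OF * this] show False
      using lines_le(5,6)[of n] by linarith
  qed
qed

text \<open>Let \<open>V\<close> be a set that no edge of the new color leaves. Each of the two lines of the new
  direction carries a complete bipartite graph between its two classes, so \<open>V\<close> contains all or
  nothing of it, and the recolored edge ties the two lines together. For \<open>n = 3\<close> the class of 3
  is empty, but then the class it should be joined with is a single vertex.\<close>

lemma new_color_crosses_cuts: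
  assumes n: "n \<ge> 3" and a: "a < n" "a mod 4 = 0" and b: "b < n" "b mod 4 = 1"
    and c: "c \<in> {2, 3}" and V: "V \<noteq> {}" "V \<subset> {..<n}"
  shows "\<exists>u\<in>V. \<exists>v\<in>{..<n} - V. {u, v} \<in> color_class n ((affine_coloring n)({a, b} := c)) c"
proof (rule ccontr)
  assume no: "\<not> ?thesis"
  let ?C = "color_class n ((affine_coloring n)({a, b} := c)) c"
  have same: "u \<in> V \<longleftrightarrow> v \<in> V" if "{u, v} \<in> ?C" for u v
  proof -
    have "u < n" "v < n" using that by (auto simp: recolored_class_doubleton)
    moreover have "{v, u} \<in> ?C" using that by (simp add: insert_commute)
    ultimately show ?thesis using no that by blast
  qed
  have ab: "a \<in> V \<longleftrightarrow> b \<in> V"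
    using a b by (intro same) (auto simp: recolored_class_doubleton)
  have line: "u \<in> V \<longleftrightarrow> v \<in> V"
    if "u < n" "v < n" "low u \<noteq> low v" "even u = even v \<longleftrightarrow> c = 2" for u v
  proof (rule same)
    have "{u, v} \<noteq> {a, b}" using that(3) a b by (auto simp: low_def doubleton_eq_iff)
    moreover have "u \<noteq> v" "direction u v = c"
      using that(3,4) c by (auto simp: direction_def)
    ultimately show "{u, v} \<in> ?C" using that(1,2) by (simp add: recolored_class_doubleton)
  qed
  have high_side: "x \<in> V \<longleftrightarrow> a \<in> V" if "x < n" "\<not> low x" for x
  proof (cases "even x = even a \<longleftrightarrow> c = 2")
    case True
    thus ?thesis using line[of x a] that a by (simp add: low_def)
  next
    case False
    have "even a" "odd b" using a b by presburger+
    with False have "even x = even b \<longleftrightarrow> c = 2" by auto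
    thus ?thesis using line[of x b] that b ab by (simp add: low_def)
  qed
  have low_side: "x \<in> V \<longleftrightarrow> a \<in> V" if "x < n" "low x" for x
  proof -
    have x: "x mod 4 = 0 \<or> x mod 4 = 1" using that(2) unfolding low_def by linarith
    \<comment> \<open>The smallest vertex of the other class on the line through \<open>x\<close> of the new direction.\<close>
    define y :: nat where "y = (if even x = (c = 2) then 2 else 3)"
    have y: "\<not> low y" "even x = even y \<longleftrightarrow> c = 2" by (auto simp: y_def low_def)
    show ?thesis
    proof (cases "y < n")
      case True
      thus ?thesis using line[of x y] high_side[of y] that y by simp
    next
      case False
      hence "x < 3" "a < 3" "b < 3" using n that(1) a b by (auto simp: y_def split: if_splits)
      hence "x = a \<or> x = b" using x a b by auto
      thus ?thesis using ab by blast
    qed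
  qed
  have "x \<in> V \<longleftrightarrow> a \<in> V" if "x < n" for x
    using high_side low_side that by blast
  thus False using V by blast
qed

lemma recoloring_contains_tree:
  assumes "n \<ge> 3" "a < n" "a mod 4 = 0" "b < n" "b mod 4 = 1" "c \<in> {2, 3}"
  shows "contains_member n (trees (k_fun n + 1))
    (color_class n ((affine_coloring n)({a, b} := c)) c)"
proof (rule contains_tree_if_cuts_crossed)
  show "k_fun n + 1 \<le> n"
    using assms(1) div_mult_mod_eq[of n 4] unfolding k_fun_eq
    by (cases "n div 4"; cases "n mod 4 \<le> 2"; simp add: min_def)
qed (use new_color_crosses_cuts[OF assms] in blast, simp)

lemma recoloring_valid:
  assumes "n \<ge> 3" "a < n" "a mod 4 = 0" "b < n" "b mod 4 = 1" "c \<in> {2, 3}"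
  shows "(affine_coloring n)({a, b} := c) \<in> valid_colorings n (trees (k_fun n + 1))"
proof -
  have "{a, b} \<in> edges_K n"
    using assms by (auto simp: doubleton_in_edges_K)
  hence "(affine_coloring n)({a, b} := c) \<in> colorings n"
    using affine_coloring_in_colorings[of n] assms(6) unfolding colorings_def
    by (auto simp: PiE_def extensional_def)
  moreover have "c \<in> {1..3}" using assms(6) by auto
  ultimately show ?thesis
    using recoloring_contains_tree[OF assms] unfolding valid_colorings_def by blast
qed

section \<open>The quadratic lower bound\<close>

lemma card_edges_between:
  assumes "A \<inter> B = {}"
  shows "card {{a, b} | a b. a \<in> A \<and> b \<in> B} = card A * card B"
proof -
  have "inj_on (\<lambda>(a, b). {a, b}) (A \<times> B)"
    using assms by (auto simp: inj_on_def doubleton_eq_iff)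
  moreover have "{{a, b} | a b. a \<in> A \<and> b \<in> B} = (\<lambda>(a, b). {a, b}) ` (A \<times> B)"
    by auto
  ultimately show ?thesis by (simp add: card_image card_cartesian_product)
qed

lemma cornering_number_ge:
  assumes n: "n \<ge> 3"
  shows "card {v. v < n \<and> v mod 4 = 0} * card {v. v < n \<and> v mod 4 = 1}
    \<le> cornering_number (trees (k_fun n + 1)) n"
proof -
  let ?\<G> = "trees (k_fun n + 1)"
  define A where "A = {v. v < n \<and> v mod 4 = 0}"
  define B where "B = {v. v < n \<and> v mod 4 = 1}"
  define D where "D = {{a, b} | a b. a \<in> A \<and> b \<in> B}"
  have "builder_can_win n (valid_colorings n ?\<G>) (cornering_won n ?\<G>) (cornering_number ?\<G> n)"
    unfolding cornering_number_def
    by (rule LeastI[where P = "builder_can_win n (valid_colorings n ?\<G>) (cornering_won n ?\<G>)",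
          OF cornering_winnable]) (use n in simp)
  hence "card D \<le> cornering_number ?\<G> n"
  proof (rule cornering_win_needs_pivotal_edges)
    fix e assume "e \<in> D"
    then obtain a b where e: "e = {a, b}" and ab: "a < n" "a mod 4 = 0" "b < n" "b mod 4 = 1"
      by (auto simp: D_def A_def B_def)
    show "\<exists>c c'. (affine_coloring n)(e := c) \<in> valid_colorings n ?\<G> \<and>
        (affine_coloring n)(e := c') \<in> valid_colorings n ?\<G> \<and>
        (\<forall>i\<in>{1..3}. \<not> (contains_member n ?\<G> (color_class n ((affine_coloring n)(e := c)) i) \<and>
                       contains_member n ?\<G> (color_class n ((affine_coloring n)(e := c')) i)))"
    proof (intro exI conjI ballI)
      show "(affine_coloring n)(e := 2) \<in> valid_colorings n ?\<G>"
        "(affine_coloring n)(e := 3) \<in> valid_colorings n ?\<G>"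
        using recoloring_valid[OF n ab] by (simp_all add: e)
    next
      fix i :: nat assume "i \<in> {1..3}"
      moreover have "i \<noteq> 2 \<or> i \<noteq> 3" by simp
      ultimately show "\<not> (contains_member n ?\<G> (color_class n ((affine_coloring n)(e := 2)) i) \<and>
          contains_member n ?\<G> (color_class n ((affine_coloring n)(e := 3)) i))"
        using unchanged_color_has_no_large_tree by blast
    qed
  qed
  moreover have "card D = card A * card B"
    unfolding D_def by (rule card_edges_between) (auto simp: A_def B_def)
  ultimately show ?thesis by (simp add: A_def B_def)
qed

theorem theorem3:
  shows "(\<forall>n\<ge>3. locating_number (trees (k_fun n + 1)) n \<ge> cornering_number (trees (k_fun n + 1)) n) \<and>
    (\<exists>c::real. c > 0 \<and>
      (\<forall>n\<ge>3. real (cornering_number (trees (k_fun n + 1)) n) \<ge> c * (real n)\<^sup>2))"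
proof (intro conjI exI allI impI)
  fix n :: nat assume n: "n \<ge> 3"
  show "cornering_number (trees (k_fun n + 1)) n \<le> locating_number (trees (k_fun n + 1)) n"
    using n by (intro cornering_le_locating) simp
  define A B where "A = card {v. v < n \<and> v mod 4 = 0}" and "B = card {v. v < n \<and> v mod 4 = 1}"
  define m r where "m = n div 4" and "r = n mod 4"
  have AB: "A = m + (if 0 < r then 1 else 0)" "B = m + (if 1 < r then 1 else 0)"
    unfolding A_def B_def m_def r_def by (rule card_residue_class; simp)+
  have nmr: "n = 4 * m + r" and "r < 4" by (simp_all add: m_def r_def)
  then consider "r = 0" | "r = 1" | "r = 2" | "r = 3" by linarith
  \<comment> \<open>For \<open>n = 5\<close> only one vertex lies in the second class, so 6 cannot be lowered to 4.\<close>
  hence "n \<le> 4 * A \<and> n \<le> 6 * B"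
    by cases (use n in \<open>simp_all add: nmr AB\<close>)
  hence A: "real n / 4 \<le> real A" and B: "real n / 6 \<le> real B" by linarith+
  have "1 / 24 * (real n)\<^sup>2 = (real n / 4) * (real n / 6)"
    by (simp add: power2_eq_square)
  also have "\<dots> \<le> real A * real B"
    using A B by (intro mult_mono) auto
  also have "\<dots> \<le> real (cornering_number (trees (k_fun n + 1)) n)"
    using cornering_number_ge[OF n] by (simp add: A_def B_def flip: of_nat_mult)
  finally show "1 / 24 * (real n)\<^sup>2 \<le> real (cornering_number (trees (k_fun n + 1)) n)" .
qed simp

end
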